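(* Let $A\in\mathbb R^{n\times m}$ have rank at most $r$, with truncated singular value decomposition $A=USV^\top$, where $U\in\mathbb R^{n\times r}$ and $V\in\mathbb R^{m\times r}$ have orthonormal columns and $S\in\mathbb R^{r\times r}$ is diagonal, and let $Y\in\mathbb R^{m\times(m-r)}$ satisfy $AY=0$ and $Y^\top Y=I_{m-r}$. Let $$N=\begin{bmatrix}Y^\top\otimes I_n & I_{m-r}\otimes A\\ 0 & I_{m-r}\otimes Y^\top\end{bmatrix}.$$ Then the orthogonal basis in the kernel of $N$ is given by the columns of the matrix $$Q=\begin{bmatrix}V\otimes I_n & -Y\otimes(US_1)\\ 0& I_{m-r}\otimes(VS_2)\end{bmatrix},$$ where $S_1$ and $S_2$ are the diagonal matrices defined as $S_1=S(S^2+I_r)^{-1/2}$ and $S_2=(S^2+I_r)^{-1/2}$.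
   Context: Here $n,m,r$ are integers for which these matrices make sense (so $r\le\min(n,m)$), $\otimes$ denotes the Kronecker product of matrices, and $I_k$ is the $k\times k$ identity matrix. The diagonal entries of $S$ are the (nonnegative) singular values of $A$ retained in the truncated singular value decomposition. Orthogonality is with respect to the standard Euclidean inner product on $\mathbb R^{nm+m(m-r)}$.
   Formalization: When rank A < r, the formal statement additionally assumes VᵀY = 0 (automatic if rank A = r); without it the claim fails, e.g. n = 1, m = 2, r = 1, A = [0 0], U = [1], S = [0], V = Y = e₁ gives NQ ≠ 0. *)

theory Defs
  imports Complex_Main
    "Jordan_Normal_Form.Matrix_Kernel"
    "Jordan_Normal_Form.DL_Rank"
    "Jordan_Normal_Form.Gram_Schmidt"
begin

text \<open>Matrices are those of Jordan-Normal-Form: dimensions are natural numbers, entries are indexed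
  from 0, and dimension 0 is allowed (so that \<^term>\<open>r = 0\<close> and \<^term>\<open>m = r\<close> are covered).\<close>

definition kron :: "'a::times mat \<Rightarrow> 'a mat \<Rightarrow> 'a mat"  (infixl "\<otimes>\<^sub>K" 70) where
  "A \<otimes>\<^sub>K B = mat (dim_row A * dim_row B) (dim_col A * dim_col B)
     (\<lambda>(i, j). A $$ (i div dim_row B, j div dim_col B) * B $$ (i mod dim_row B, j mod dim_col B))"

lemma kron_carrier [simp]:
  assumes "A \<in> carrier_mat a b" "B \<in> carrier_mat c d"
  shows "A \<otimes>\<^sub>K B \<in> carrier_mat (a * c) (b * d)"
  using assms by (simp add: kron_def)

text \<open>Real power of a diagonal matrix with positive diagonal entries. The lemma
  \<open>diag_powr_inverse_sqrt\<close> confirms that exponent \<open>-1/2\<close> gives the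
  inverse square root.\<close>

definition diag_powr :: "real mat \<Rightarrow> real \<Rightarrow> real mat" where
  "diag_powr D a = mat_diag (dim_row D) (\<lambda>i. (D $$ (i, i)) powr a)"

lemma diag_powr_inverse_sqrt:
  assumes D: "D \<in> carrier_mat k k" "diagonal_mat D"
    and pos: "\<And>i. i < k \<Longrightarrow> 0 < D $$ (i, i)"
  shows "diag_powr D (- 1 / 2) * diag_powr D (- 1 / 2) * D = 1\<^sub>m k"
proof -
  have D': "D = mat_diag k (\<lambda>i. D $$ (i, i))"
    using D by (intro eq_matI) (auto simp: mat_diag_def diagonal_mat_def)
  have "diag_powr D (- 1 / 2) * diag_powr D (- 1 / 2) * D
      = mat_diag k (\<lambda>i. (D $$ (i, i)) powr (- 1 / 2)) * mat_diag k (\<lambda>i. (D $$ (i, i)) powr (- 1 / 2))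
        * mat_diag k (\<lambda>i. D $$ (i, i))"
    using D(1) D' by (simp add: diag_powr_def)
  also have "\<dots> = mat_diag k (\<lambda>i. (D $$ (i, i)) powr (- 1 / 2) * (D $$ (i, i)) powr (- 1 / 2) * D $$ (i, i))"
    by simp
  also have "\<dots> = 1\<^sub>m k"
  proof -
    have "x powr (- 1 / 2) * x powr (- 1 / 2) * x = 1" if "0 < x" for x :: real
    proof -
      have "x powr (- 1 / 2) * x powr (- 1 / 2) = x powr (- 1)"
        by (simp only: powr_add[symmetric]) simp
      then show ?thesis using that by (simp add: powr_minus)
    qed
    then show ?thesis using pos by (intro eq_matI) (simp_all add: mat_diag_def)
  qed
  finally show ?thesis .
qed

text \<open>\<open>A = U S V\<^sup>T\<close> with \<open>r\<close> retained singular values. Some of them may be zero, and no ordering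
  of the singular values is imposed.\<close>

definition truncated_svd ::
  "nat \<Rightarrow> nat \<Rightarrow> nat \<Rightarrow> real mat \<Rightarrow> real mat \<Rightarrow> real mat \<Rightarrow> real mat \<Rightarrow> bool" where
  "truncated_svd n m r A U S V \<longleftrightarrow>
     U \<in> carrier_mat n r \<and> S \<in> carrier_mat r r \<and> V \<in> carrier_mat m r \<and>
     transpose_mat U * U = 1\<^sub>m r \<and> transpose_mat V * V = 1\<^sub>m r \<and>
     diagonal_mat S \<and> (\<forall>i<r. 0 \<le> S $$ (i, i)) \<and>
     A = U * S * transpose_mat V"

text \<open>\<^const>\<open>orthogonal\<close> is with respect to the standard scalar product; distinctness makes the
  family of columns, and not merely the set of its values, a basis.\<close>

definition columns_orthogonal_basis_of_kernel :: "real mat \<Rightarrow> real mat \<Rightarrow> bool" where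
  "columns_orthogonal_basis_of_kernel Q N \<longleftrightarrow>
     distinct (cols Q) \<and>
     kernel.basis (dim_col N) N (set (cols Q)) \<and>
     orthogonal (cols Q)"

end

theory Submission
  imports Defs
begin

text \<open>
  Put \<open>k = m - r\<close> and \<open>P = U S1\<^sup>2 U\<^sup>T\<close>. The proof rests on three matrix identities:
  \<open>Q\<^sup>T Q = I\<close>, \<open>N Q = 0\<close> and \<open>Q Q\<^sup>T + M N = I\<close>, where
  \<open>M\<close> is the explicit block matrix

  \<^item> \<open>M = [ Y \<otimes> (I\<^sub>n - P),  0 ; I\<^sub>k \<otimes> (V S1 S2 U\<^sup>T),  I\<^sub>k \<otimes> Y ]\<close>.

  The first identity makes the columns of \<open>Q\<close> orthonormal, hence distinct and independent; the
  second puts them into the kernel; the third shows that they span it, since \<open>N x = 0\<close> implies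
  \<open>x = Q (Q\<^sup>T x)\<close> (\<open>orthonormal_columns_basis_of_kernel\<close>).

  With \<open>(A \<otimes> B) (C \<otimes> D) = (A C) \<otimes> (B D)\<close>, every block of these identities reduces to
  the orthonormality of the columns of \<open>U\<close>, \<open>V\<close> and \<open>Y\<close>, to \<open>V\<^sup>T Y = 0\<close>,
  \<open>V V\<^sup>T + Y Y\<^sup>T = I\<close>, and to the relations \<open>S S2 = S1\<close> and \<open>S1\<^sup>2 + S2\<^sup>2 = I\<close> between
  diagonal matrices. The last one is the reason for the normalising factor
  \<open>(S\<^sup>2 + I)\<^bsup>-1/2\<^esup>\<close>. Since \<open>V\<^sup>T Y = 0\<close>, the matrices \<open>V\<close> and \<open>Y\<close> side by side form
  a square matrix with orthonormal columns, which gives \<open>V V\<^sup>T + Y Y\<^sup>T = I\<close>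
  (\<open>orthonormal_columns_complete\<close>).

  The relation \<open>V\<^sup>T Y = 0\<close> is where the rank of \<open>A\<close> enters. From \<open>A Y = 0\<close> one only
  gets \<open>S V\<^sup>T Y = 0\<close>; if \<open>A\<close> has rank \<open>r\<close>, no diagonal entry of \<open>S\<close> vanishes, because
  \<open>A\<close> is a sum of as many matrices of rank at most 1 as \<open>S\<close> has nonzero diagonal entries
  (\<open>kernel_orthogonal_if_full_rank\<close>). If the rank is smaller, \<open>V\<^sup>T Y = 0\<close> is a hypothesis.
\<close>

section \<open>Matrix arithmetic\<close>

text \<open>The form of associativity that the simplifier can apply by itself: its side conditions
  contain no dimension that is absent from the left-hand side. The distributive laws in
  \<open>mat_distrib_dim\<close> are stated in the same way.\<close>

lemma mat_mult_assoc:
  fixes A B C :: "'a::semiring_0 mat"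
  assumes "dim_col A = dim_row B" "dim_col B = dim_row C"
  shows "A * B * C = A * (B * C)"
  by (rule assoc_mult_mat[of A "dim_row A" "dim_row B" B "dim_row C" C "dim_col C"]) (use assms in auto)

lemma mat_distrib_dim:
  fixes A B C :: "'a::ring mat"
  shows "\<lbrakk>dim_row A = dim_row B; dim_col A = dim_col B; dim_col A = dim_row C\<rbrakk>
      \<Longrightarrow> (A - B) * C = A * C - B * C"
    and "\<lbrakk>dim_row A = dim_row B; dim_col A = dim_col B; dim_row A = dim_col C\<rbrakk>
      \<Longrightarrow> C * (A - B) = C * A - C * B"
    and "\<lbrakk>dim_row A = dim_row B; dim_col A = dim_col B; dim_row A = dim_col C\<rbrakk>
      \<Longrightarrow> C * (A + B) = C * A + C * B"
    and "\<lbrakk>dim_row A = dim_row B; dim_col A = dim_col B; dim_col A = dim_row C\<rbrakk>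
      \<Longrightarrow> (A + B) * C = A * C + B * C"
  by (rule minus_mult_distrib_mat[of _ "dim_row B" "dim_col B" _ _ "dim_col C"]
      mult_minus_distrib_mat[of _ "dim_row C" "dim_row B" _ "dim_col B"]
      mult_add_distrib_mat[of _ "dim_row C" "dim_row B" _ "dim_col B"]
      add_mult_distrib_mat[of _ "dim_row B" "dim_col B" _ _ "dim_col C"]; auto)+

lemma mat_uminus_add:
  fixes X :: "'a::group_add mat"
  shows "- X + X = 0\<^sub>m (dim_row X) (dim_col X)"
  by (rule eq_matI) auto

lemma mat_uminus_zero: "- 0\<^sub>m a b = (0\<^sub>m a b :: 'a::group_add mat)"
  by (rule eq_matI) auto

lemma mat_diff_eqI:
  fixes X Y Z :: "'a::ab_group_add mat"
  assumes eq: "X = Y + Z" and "dim_row Y = dim_row Z" "dim_col Y = dim_col Z"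
  shows "X - Y = Z"
  unfolding eq by (rule eq_matI) (use assms in auto)

section \<open>Kronecker products\<close>

lemma dim_kron [simp]:
  "dim_row (A \<otimes>\<^sub>K B) = dim_row A * dim_row B" "dim_col (A \<otimes>\<^sub>K B) = dim_col A * dim_col B"
  by (simp_all add: kron_def)

lemma index_kron:
  assumes "i < dim_row A * dim_row B" "j < dim_col A * dim_col B"
  shows "(A \<otimes>\<^sub>K B) $$ (i, j)
    = A $$ (i div dim_row B, j div dim_col B) * B $$ (i mod dim_row B, j mod dim_col B)"
  using assms by (simp add: kron_def)

lemma div_mod_less_of_less_mult:
  fixes i p q :: nat
  assumes "i < p * q"
  shows "i div q < p" "i mod q < q"
proof -
  have "0 < q" using assms by (cases q) auto
  then show "i mod q < q" by simp
  show "i div q < p" using assms by (simp add: less_mult_imp_div_less)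
qed

text \<open>The inner index \<open>k < p * q\<close> of a product of Kronecker products encodes the pair
  \<open>(k div q, k mod q)\<close>, so a sum over it factors. For \<open>q = 0\<close> both sides are 0.\<close>

lemma sum_div_mod_mult:
  fixes f g :: "nat \<Rightarrow> 'a::semiring_0"
  shows "(\<Sum>k<p * q. f (k div q) * g (k mod q)) = (\<Sum>k<p. f k) * (\<Sum>k<q. g k)"
proof -
  have "(\<Sum>k<p * q. f (k div q) * g (k mod q))
      = (\<Sum>a<p. \<Sum>k\<in>{a * q..<a * q + q}. f (k div q) * g (k mod q))"
    by (simp add: sum.nat_group)
  also have "\<dots> = (\<Sum>a<p. \<Sum>b<q. f a * g b)"
  proof (rule sum.cong[OF refl])
    fix a
    have "(\<Sum>k\<in>{a * q..<a * q + q}. f (k div q) * g (k mod q))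
        = (\<Sum>b\<in>{0..<q}. f ((b + a * q) div q) * g ((b + a * q) mod q))"
      using sum.shift_bounds_nat_ivl[of "\<lambda>k. f (k div q) * g (k mod q)" 0 "a * q" q]
      by (simp add: add.commute)
    also have "\<dots> = (\<Sum>b<q. f a * g b)"
      by (rule sum.cong) auto
    finally show "(\<Sum>k\<in>{a * q..<a * q + q}. f (k div q) * g (k mod q)) = (\<Sum>b<q. f a * g b)" .
  qed
  also have "\<dots> = (\<Sum>k<p. f k) * (\<Sum>k<q. g k)"
    by (simp add: sum_product)
  finally show ?thesis .
qed

lemma kron_mult_kron:
  fixes A B C D :: "'a::comm_semiring_0 mat"
  assumes "dim_col A = dim_row C" "dim_col B = dim_row D"
  shows "(A \<otimes>\<^sub>K B) * (C \<otimes>\<^sub>K D) = (A * C) \<otimes>\<^sub>K (B * D)"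
proof (rule eq_matI)
  fix i j
  assume "i < dim_row ((A * C) \<otimes>\<^sub>K (B * D))" "j < dim_col ((A * C) \<otimes>\<^sub>K (B * D))"
  then have i: "i < dim_row A * dim_row B" and j: "j < dim_col C * dim_col D" by auto
  note ij = div_mod_less_of_less_mult[OF i] div_mod_less_of_less_mult[OF j]
  let ?f = "\<lambda>k. A $$ (i div dim_row B, k) * C $$ (k, j div dim_col D)"
  let ?g = "\<lambda>k. B $$ (i mod dim_row B, k) * D $$ (k, j mod dim_col D)"
  have "((A \<otimes>\<^sub>K B) * (C \<otimes>\<^sub>K D)) $$ (i, j)
      = (\<Sum>k<dim_row C * dim_row D. (A \<otimes>\<^sub>K B) $$ (i, k) * (C \<otimes>\<^sub>K D) $$ (k, j))"
    using i j assms by (simp add: scalar_prod_def atLeast0LessThan)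
  also have "\<dots> = (\<Sum>k<dim_row C * dim_row D. ?f (k div dim_row D) * ?g (k mod dim_row D))"
    using i j assms by (intro sum.cong) (simp_all add: index_kron ac_simps)
  also have "\<dots> = (\<Sum>k<dim_row C. ?f k) * (\<Sum>k<dim_row D. ?g k)"
    by (rule sum_div_mod_mult)
  also have "\<dots> = ((A * C) \<otimes>\<^sub>K (B * D)) $$ (i, j)"
    using i j ij assms by (simp add: index_kron scalar_prod_def atLeast0LessThan)
  finally show "((A \<otimes>\<^sub>K B) * (C \<otimes>\<^sub>K D)) $$ (i, j) = ((A * C) \<otimes>\<^sub>K (B * D)) $$ (i, j)" .
qed (use assms in auto)

lemma transpose_kron: "transpose_mat (A \<otimes>\<^sub>K B) = transpose_mat A \<otimes>\<^sub>K transpose_mat B"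
  by (rule eq_matI) (auto simp: index_kron div_mod_less_of_less_mult)

lemma one_kron_one: "(1\<^sub>m p :: 'a::semiring_1 mat) \<otimes>\<^sub>K 1\<^sub>m q = 1\<^sub>m (p * q)"
proof (rule eq_matI)
  fix i j assume "i < dim_row (1\<^sub>m (p * q) :: 'a mat)" "j < dim_col (1\<^sub>m (p * q) :: 'a mat)"
  then have i: "i < p * q" and j: "j < p * q" by auto
  have "i = j \<longleftrightarrow> i div q = j div q \<and> i mod q = j mod q"
    by (metis mult_div_mod_eq)
  then show "((1\<^sub>m p :: 'a mat) \<otimes>\<^sub>K 1\<^sub>m q) $$ (i, j) = (1\<^sub>m (p * q) :: 'a mat) $$ (i, j)"
    using i j by (auto simp: index_kron div_mod_less_of_less_mult)
qed auto

lemma zero_kron: "(0\<^sub>m a b :: 'a::mult_zero mat) \<otimes>\<^sub>K B = 0\<^sub>m (a * dim_row B) (b * dim_col B)"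
  and kron_zero: "B \<otimes>\<^sub>K (0\<^sub>m a b :: 'a mat) = 0\<^sub>m (dim_row B * a) (dim_col B * b)"
  by (rule eq_matI; auto simp: index_kron div_mod_less_of_less_mult)+

lemma add_kron:
  fixes A B C :: "'a::semiring mat"
  assumes "dim_row A = dim_row B" "dim_col A = dim_col B"
  shows "A \<otimes>\<^sub>K C + B \<otimes>\<^sub>K C = (A + B) \<otimes>\<^sub>K C"
  by (rule eq_matI) (use assms in \<open>auto simp: index_kron div_mod_less_of_less_mult distrib_right\<close>)

lemma kron_add:
  fixes A B C :: "'a::semiring mat"
  assumes "dim_row A = dim_row B" "dim_col A = dim_col B"
  shows "C \<otimes>\<^sub>K A + C \<otimes>\<^sub>K B = C \<otimes>\<^sub>K (A + B)"
  by (rule eq_matI) (use assms in \<open>auto simp: index_kron div_mod_less_of_less_mult distrib_left\<close>)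

lemma uminus_kron: "(- A) \<otimes>\<^sub>K (B :: 'a::ring mat) = - (A \<otimes>\<^sub>K B)"
  by (rule eq_matI) (auto simp: index_kron div_mod_less_of_less_mult)

section \<open>Orthonormal kernel bases from a splitting of the identity\<close>

text \<open>The hypothesis \<open>split\<close> replaces a rank computation: applied to a kernel vector \<open>x\<close> it
  reads \<open>x = Q (Q\<^sup>T x)\<close>, which exhibits \<open>x\<close> as a combination of the columns of \<open>Q\<close>.\<close>

lemma orthonormal_columns_basis_of_kernel:
  fixes N Q M :: "real mat"
  assumes N: "N \<in> carrier_mat e d" and Q: "Q \<in> carrier_mat d k" and M: "M \<in> carrier_mat d e"
    and QQ: "transpose_mat Q * Q = 1\<^sub>m k"
    and NQ: "N * Q = 0\<^sub>m e k"
    and split: "Q * transpose_mat Q + M * N = 1\<^sub>m d"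
  shows "columns_orthogonal_basis_of_kernel Q N"
proof -
  interpret kernel e d N by unfold_locales (rule N)
  have col_col: "col Q i \<bullet> col Q j = (if i = j then 1 else 0)" if "i < k" "j < k" for i j
  proof -
    have "(transpose_mat Q * Q) $$ (i, j) = (1\<^sub>m k :: real mat) $$ (i, j)" using QQ by simp
    then show ?thesis using that Q by simp
  qed
  have distinct: "distinct (cols Q)"
    unfolding distinct_conv_nth
  proof (intro allI impI)
    fix i j assume "i < length (cols Q)" "j < length (cols Q)" "i \<noteq> j"
    then show "cols Q ! i \<noteq> cols Q ! j"
      using col_col[of i i] col_col[of i j] Q by auto
  qed
  have orth: "orthogonal (cols Q)"
    by (rule orthogonalI) (use col_col Q in \<open>auto split: if_splits\<close>)
  have in_ker: "set (cols Q) \<subseteq> mat_kernel N"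
  proof
    fix v assume "v \<in> set (cols Q)"
    then obtain j where j: "j < k" "v = col Q j"
      using Q by (auto simp: in_set_conv_nth)
    have "N *\<^sub>v col Q j = col (N * Q) j"
      using N Q j(1) by (intro eq_vecI) auto
    then show "v \<in> mat_kernel N"
      using NQ N Q j by (intro mat_kernelI[OF N]) auto
  qed
  have indpt: "NC.lin_indpt (set (cols Q))"
  proof
    assume "NC.lin_dep (set (cols Q))"
    then obtain v where v: "v \<in> carrier_vec k" "v \<noteq> 0\<^sub>v k" "Q *\<^sub>v v = 0\<^sub>v d"
      using NC.lin_depE[OF Q _ distinct] by blast
    have "v = transpose_mat Q * Q *\<^sub>v v" using QQ v(1) by simp
    also have "\<dots> = transpose_mat Q *\<^sub>v (Q *\<^sub>v v)"
      using Q v(1) by (intro assoc_mult_mat_vec[of _ k d _ k]) auto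
    also have "\<dots> = 0\<^sub>v k" using Q v(3) by auto
    finally show False using v(2) by simp
  qed
  have span: "mat_kernel N \<subseteq> NC.span (set (cols Q))"
  proof
    fix x assume "x \<in> mat_kernel N"
    then have x: "x \<in> carrier_vec d" and Nx: "N *\<^sub>v x = 0\<^sub>v e"
      using mat_kernelD[OF N] by auto
    have "x = (Q * transpose_mat Q + M * N) *\<^sub>v x" using split x by simp
    also have "\<dots> = (Q * transpose_mat Q) *\<^sub>v x + (M * N) *\<^sub>v x"
      by (rule add_mult_distrib_mat_vec[of _ d d]) (use Q M N x in auto)
    also have "(M * N) *\<^sub>v x = M *\<^sub>v (N *\<^sub>v x)"
      using M N x by (intro assoc_mult_mat_vec[of _ d e _ d]) auto
    also have "\<dots> = 0\<^sub>v d" using M Nx by auto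
    also have "(Q * transpose_mat Q) *\<^sub>v x = Q *\<^sub>v (transpose_mat Q *\<^sub>v x)"
      using Q x by (intro assoc_mult_mat_vec[of _ d k _ d]) auto
    also have "\<dots> = NC.lincomb (\<lambda>a. (transpose_mat Q *\<^sub>v x) $ find_first a (cols Q)) (set (cols Q))"
      using NC.lincomb_eq_mat_mult[OF Q _ distinct, of "transpose_mat Q *\<^sub>v x"] Q x by auto
    finally have "x = NC.lincomb (\<lambda>a. (transpose_mat Q *\<^sub>v x) $ find_first a (cols Q)) (set (cols Q))"
      using Q cols_dim[of Q] by (auto simp: NC.lincomb_closed)
    then show "x \<in> NC.span (set (cols Q))"
      unfolding NC.span_def by auto
  qed
  have "span (set (cols Q)) = mat_kernel N"
    using span span_same[OF in_ker] Ker.span_is_subset2[OF in_ker] by auto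
  then have "basis (set (cols Q))"
    unfolding Ker.basis_def using indpt lindep_same[OF in_ker] in_ker by auto
  then show ?thesis
    using distinct orth N unfolding columns_orthogonal_basis_of_kernel_def by simp
qed

section \<open>The rank and the nonzero singular values\<close>

lemma rank_sum_of_products_le:
  fixes f g :: "'b \<Rightarrow> nat \<Rightarrow> 'a::field"
  assumes "finite J"
  shows "vec_space.rank n (mat n m (\<lambda>(a, b). \<Sum>j\<in>J. f j a * g j b)) \<le> card J"
  using assms
proof (induction J rule: finite_induct)
  case empty
  have "mat n m (\<lambda>(a, b). \<Sum>j\<in>{}. f j a * g j b) = 0\<^sub>m n m"
    by (rule eq_matI) auto
  then show ?case unfolding \<open>mat n m (\<lambda>(a, b). \<Sum>j\<in>{}. f j a * g j b) = 0\<^sub>m n m\<close> by (simp add: vec_space.rank_0I)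
next
  case (insert i J)
  let ?R = "mat n m (\<lambda>(a, b). f i a * g i b)"
  let ?B = "mat n m (\<lambda>(a, b). \<Sum>j\<in>J. f j a * g j b)"
  have "vec_space.rank n (mat n m (\<lambda>(a, b). \<Sum>j\<in>insert i J. f j a * g j b))
      = vec_space.rank n (?R + ?B)"
    using insert.hyps by (intro arg_cong[of _ _ "vec_space.rank n"] eq_matI) auto
  also have "\<dots> \<le> vec_space.rank n ?R + vec_space.rank n ?B"
    by (rule vec_space.rank_subadditive) auto
  also have "vec_space.rank n ?R \<le> 1"
    by (rule vec_space.rank_le_1_product_entries[of _ _ m "f i" "g i"]) auto
  finally show ?case using insert by simp
qed


lemma mat_diag_entries:
  assumes "S \<in> carrier_mat r r" "diagonal_mat S"
  shows "S = mat_diag r (\<lambda>i. S $$ (i, i))"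
  using assms by (intro eq_matI) (auto simp: mat_diag_def diagonal_mat_def)

text \<open>\<open>A\<close> is the sum of the matrices \<open>s\<^sub>j u\<^sub>j v\<^sub>j\<^sup>T\<close>, each of rank at most 1, and the terms with
  \<open>s\<^sub>j = 0\<close> can be dropped.\<close>

lemma rank_le_card_nonzero_singular_values:
  assumes svd: "truncated_svd n m r A U S V"
  shows "vec_space.rank n A \<le> card {j. j < r \<and> S $$ (j, j) \<noteq> 0}"
proof -
  have U: "U \<in> carrier_mat n r" and S: "S \<in> carrier_mat r r" "diagonal_mat S"
    and V: "V \<in> carrier_mat m r" and A: "A = U * S * transpose_mat V"
    using svd by (auto simp: truncated_svd_def)
  have US: "U * S = mat n r (\<lambda>(a, j). U $$ (a, j) * S $$ (j, j))"
    by (subst mat_diag_entries[OF S], rule mat_diag_mult_right[OF U])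
  let ?J = "{j. j < r \<and> S $$ (j, j) \<noteq> 0}"
  have "A = mat n m (\<lambda>(a, b). \<Sum>j\<in>?J. (U $$ (a, j) * S $$ (j, j)) * V $$ (b, j))"
  proof (rule eq_matI)
    fix a b
    assume "a < dim_row (mat n m (\<lambda>(a, b). \<Sum>j\<in>?J. (U $$ (a, j) * S $$ (j, j)) * V $$ (b, j)))"
      "b < dim_col (mat n m (\<lambda>(a, b). \<Sum>j\<in>?J. (U $$ (a, j) * S $$ (j, j)) * V $$ (b, j)))"
    then have ab: "a < n" "b < m" by auto
    have "A $$ (a, b) = (\<Sum>j\<in>{..<r}. (U $$ (a, j) * S $$ (j, j)) * V $$ (b, j))"
      using ab V unfolding A US by (simp add: scalar_prod_def atLeast0LessThan)
    also have "\<dots> = (\<Sum>j\<in>?J. (U $$ (a, j) * S $$ (j, j)) * V $$ (b, j))"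
      by (rule sum.mono_neutral_right) auto
    finally show "A $$ (a, b)
        = mat n m (\<lambda>(a, b). \<Sum>j\<in>?J. (U $$ (a, j) * S $$ (j, j)) * V $$ (b, j)) $$ (a, b)"
      using ab by simp
  qed (use U V A in auto)
  then show ?thesis
    using rank_sum_of_products_le[of ?J n m "\<lambda>j a. U $$ (a, j) * S $$ (j, j)" "\<lambda>j b. V $$ (b, j)"]
    by simp
qed

text \<open>Multiplying \<open>A Y = 0\<close> by \<open>U\<^sup>T\<close> gives \<open>S V\<^sup>T Y = 0\<close>, and full rank allows
  to cancel \<open>S\<close>.\<close>

lemma kernel_orthogonal_if_full_rank:
  assumes svd: "truncated_svd n m r A U S V"
    and full: "r \<le> vec_space.rank n A"
    and Y: "Y \<in> carrier_mat m k" and AY: "A * Y = 0\<^sub>m n k"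
  shows "transpose_mat V * Y = 0\<^sub>m r k"
proof (rule eq_matI)
  have U: "U \<in> carrier_mat n r" and S: "S \<in> carrier_mat r r" "diagonal_mat S"
    and V: "V \<in> carrier_mat m r" and A: "A = U * S * transpose_mat V"
    and UU: "transpose_mat U * U = 1\<^sub>m r"
    using svd by (auto simp: truncated_svd_def)
  have nz: "S $$ (i, i) \<noteq> 0" if i: "i < r" for i
  proof
    assume "S $$ (i, i) = 0"
    then have "{j. j < r \<and> S $$ (j, j) \<noteq> 0} \<subseteq> {..<r} - {i}" by auto
    from card_mono[OF _ this] have "card {j. j < r \<and> S $$ (j, j) \<noteq> 0} \<le> r - 1"
      using i by simp
    with rank_le_card_nonzero_singular_values[OF svd] full i show False by simp
  qed
  have VY: "transpose_mat V * Y \<in> carrier_mat r k" using V Y by auto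
  have "S * (transpose_mat V * Y) = transpose_mat U * U * (S * (transpose_mat V * Y))"
    unfolding UU using S VY by simp
  also have "\<dots> = transpose_mat U * (A * Y)"
    using U S V Y by (simp add: A mat_mult_assoc)
  also have "\<dots> = 0\<^sub>m r k" using U by (simp add: AY)
  finally have SVY: "mat_diag r (\<lambda>i. S $$ (i, i)) * (transpose_mat V * Y) = 0\<^sub>m r k"
    using mat_diag_entries[OF S] by simp
  fix i j assume "i < dim_row (0\<^sub>m r k :: real mat)" "j < dim_col (0\<^sub>m r k :: real mat)"
  then have ij: "i < r" "j < k" by auto
  have "S $$ (i, i) * (transpose_mat V * Y) $$ (i, j) = 0"
    using arg_cong[OF SVY, of "\<lambda>X. X $$ (i, j)"] ij
    by (simp add: mat_diag_mult_left[OF VY] del: index_mult_mat)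
  with nz[OF ij(1)] show "(transpose_mat V * Y) $$ (i, j) = (0\<^sub>m r k :: real mat) $$ (i, j)"
    using ij by simp
qed (use svd Y in \<open>auto simp: truncated_svd_def\<close>)

section \<open>The kernel of the block matrix\<close>

text \<open>The square matrix \<open>W = [V Y]\<close> satisfies \<open>W\<^sup>T W = I\<close>, hence also \<open>W W\<^sup>T = I\<close>.\<close>

lemma orthonormal_columns_complete:
  fixes V Y :: "'a::field mat"
  assumes V: "V \<in> carrier_mat (r + k) r" and Y: "Y \<in> carrier_mat (r + k) k"
    and VV: "transpose_mat V * V = 1\<^sub>m r" and YY: "transpose_mat Y * Y = 1\<^sub>m k"
    and VY: "transpose_mat V * Y = 0\<^sub>m r k"
  shows "V * transpose_mat V + Y * transpose_mat Y = 1\<^sub>m (r + k)"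
proof -
  \<comment> \<open>Blocks with zero rows or columns express the horizontal and the vertical concatenation.\<close>
  let ?W = "four_block_mat V Y (0\<^sub>m 0 r) (0\<^sub>m 0 k)"
  let ?Wt = "four_block_mat (transpose_mat V) (0\<^sub>m r 0) (transpose_mat Y) (0\<^sub>m k 0)"
  have "transpose_mat Y * V = transpose_mat (transpose_mat V * Y)"
    using V Y by (simp add: transpose_mult[of _ r "r + k"])
  then have YV: "transpose_mat Y * V = 0\<^sub>m k r" unfolding VY by simp
  have W: "?W \<in> carrier_mat (r + k) (r + k)" and Wt: "?Wt \<in> carrier_mat (r + k) (r + k)"
    using V Y by auto
  have "?Wt * ?W = four_block_mat (1\<^sub>m r) (0\<^sub>m r k) (0\<^sub>m k r) (1\<^sub>m k)"
    using V Y by (subst mult_four_block_mat[of _ r "r + k" _ 0 _ k _ _ r _ k])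
      (auto simp: VV YY VY YV)
  then have "?Wt * ?W = 1\<^sub>m (r + k)" by simp
  then have "?W * ?Wt = 1\<^sub>m (r + k)"
    by (rule mat_mult_left_right_inverse[OF Wt W])
  also have "?W * ?Wt = four_block_mat (V * transpose_mat V + Y * transpose_mat Y)
      (0\<^sub>m (r + k) 0) (0\<^sub>m 0 (r + k)) (0\<^sub>m 0 0)"
    using V Y by (subst mult_four_block_mat[of _ "r + k" r _ k _ 0 _ _ "r + k" _ 0]) auto
  also have "\<dots> = V * transpose_mat V + Y * transpose_mat Y"
    using V Y by (intro eq_matI) auto
  finally show ?thesis .
qed

text \<open>The matrices \<open>C\<close> and \<open>D\<close> stand for \<open>S1\<close> and \<open>S2\<close>. Their diagonal form is
  replaced by the algebraic relations that the block computations need, and \<open>m - r\<close> by an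
  independent number \<open>k\<close> of columns of \<open>Y\<close>, so that no truncated subtraction occurs.\<close>

locale complemented_svd =
  fixes n r k :: nat and U S V Y C D :: "real mat"
  assumes U [simp]: "U \<in> carrier_mat n r" and S [simp]: "S \<in> carrier_mat r r"
    and V [simp]: "V \<in> carrier_mat (r + k) r" and Y [simp]: "Y \<in> carrier_mat (r + k) k"
    and C [simp]: "C \<in> carrier_mat r r" and D [simp]: "D \<in> carrier_mat r r"
    and UU: "transpose_mat U * U = 1\<^sub>m r"
    and VV: "transpose_mat V * V = 1\<^sub>m r"
    and YY: "transpose_mat Y * Y = 1\<^sub>m k"
    and VY: "transpose_mat V * Y = 0\<^sub>m r k"
    and C_sym: "transpose_mat C = C" and D_sym: "transpose_mat D = D"
    and S_D: "S * D = C" and D_S: "D * S = C"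
    and C_D: "C * D = D * C" and CC_DD: "C * C + D * D = 1\<^sub>m r"
begin

abbreviation "m \<equiv> r + k"

definition "A = U * S * transpose_mat V"

definition "N = four_block_mat
  (transpose_mat Y \<otimes>\<^sub>K 1\<^sub>m n) (1\<^sub>m k \<otimes>\<^sub>K A)
  (0\<^sub>m (k * k) (m * n)) (1\<^sub>m k \<otimes>\<^sub>K transpose_mat Y)"

definition "Q = four_block_mat
  (V \<otimes>\<^sub>K 1\<^sub>m n) ((- Y) \<otimes>\<^sub>K (U * C))
  (0\<^sub>m (k * m) (r * n)) (1\<^sub>m k \<otimes>\<^sub>K (V * D))"

definition "P = U * (C * (C * transpose_mat U))"

text \<open>Chosen so that \<open>Q Q\<^sup>T + M N = I\<close>. In the first block column of \<open>N\<close> only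
  \<open>Y\<^sup>T \<otimes> I\<close> is nonzero, so the first block column of \<open>M\<close> must produce what \<open>Q Q\<^sup>T\<close> lacks
  in its first block column; the second block column of \<open>M\<close> then corrects the rest, where
  \<open>I \<otimes> Y\<^sup>T\<close> gives the projection \<open>Y Y\<^sup>T\<close> missing from \<open>V V\<^sup>T\<close>.\<close>

definition "M = four_block_mat
  (Y \<otimes>\<^sub>K (1\<^sub>m n - P)) (0\<^sub>m (m * n) (k * k))
  (1\<^sub>m k \<otimes>\<^sub>K (V * (C * (D * transpose_mat U)))) (1\<^sub>m k \<otimes>\<^sub>K Y)"

lemma dims [simp]:
  "dim_row U = n" "dim_col U = r" "dim_row S = r" "dim_col S = r" "dim_row V = m" "dim_col V = r"
  "dim_row Y = m" "dim_col Y = k" "dim_row C = r" "dim_col C = r" "dim_row D = r" "dim_col D = r"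
  "dim_row A = n" "dim_col A = m" "dim_row P = n" "dim_col P = n"
  using U S V Y C D by (auto simp del: U S V Y C D simp: A_def P_def)

lemma carriers [simp]: "A \<in> carrier_mat n m" "P \<in> carrier_mat n n"
  by (auto intro: carrier_matI)

lemma YV: "transpose_mat Y * V = 0\<^sub>m k r"
proof -
  have "transpose_mat Y * V = transpose_mat (transpose_mat V * Y)"
    by (simp add: transpose_mult[of _ r m _ k])
  then show ?thesis unfolding VY by simp
qed

text \<open>The relations in a form that rewrites inside products associated to the right.\<close>

lemma cancel:
  "dim_row X = r \<Longrightarrow> transpose_mat U * (U * X) = X"
  "dim_row X = r \<Longrightarrow> transpose_mat V * (V * X) = X"
  "dim_row X = k \<Longrightarrow> transpose_mat Y * (Y * X) = X"
  "dim_row X = k \<Longrightarrow> transpose_mat V * (Y * X) = 0\<^sub>m r (dim_col X)"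
  "dim_row X = r \<Longrightarrow> transpose_mat Y * (V * X) = 0\<^sub>m k (dim_col X)"
  "dim_row X = r \<Longrightarrow> S * (D * X) = C * X"
  "dim_row X = r \<Longrightarrow> D * (S * X) = C * X"
  by (simp_all add: mat_mult_assoc[symmetric] UU VV YY VY YV S_D D_S)

lemma N_carrier: "N \<in> carrier_mat (k * n + k * k) (m * n + k * m)"
  and Q_carrier: "Q \<in> carrier_mat (m * n + k * m) (r * n + k * r)"
  and M_carrier: "M \<in> carrier_mat (m * n + k * m) (k * n + k * k)"
  unfolding N_def Q_def M_def by (intro carrier_matI; simp)+

lemma Q_transpose: "transpose_mat Q = four_block_mat
  (transpose_mat V \<otimes>\<^sub>K 1\<^sub>m n) (0\<^sub>m (r * n) (k * m))
  ((- transpose_mat Y) \<otimes>\<^sub>K (C * transpose_mat U)) (1\<^sub>m k \<otimes>\<^sub>K (D * transpose_mat V))"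
proof -
  have "transpose_mat (U * C) = C * transpose_mat U" "transpose_mat (V * D) = D * transpose_mat V"
    by (simp_all add: transpose_mult[of _ n r _ r] transpose_mult[of _ m r _ r] C_sym D_sym)
  then show ?thesis
    unfolding Q_def
    by (subst transpose_four_block_mat[of _ "m * n" "r * n" _ "k * r" _ "k * m"])
      (auto intro!: carrier_matI simp: transpose_kron transpose_uminus)
qed

lemma Q_orthonormal: "transpose_mat Q * Q = 1\<^sub>m (r * n + k * r)"
proof -
  let ?B1 = "transpose_mat V \<otimes>\<^sub>K 1\<^sub>m n" and ?B2 = "(- transpose_mat Y) \<otimes>\<^sub>K (C * transpose_mat U)"
    and ?B3 = "1\<^sub>m k \<otimes>\<^sub>K (D * transpose_mat V)"
    and ?A1 = "V \<otimes>\<^sub>K 1\<^sub>m n" and ?A2 = "(- Y) \<otimes>\<^sub>K (U * C)" and ?A3 = "1\<^sub>m k \<otimes>\<^sub>K (V * D)"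
  have 11: "?B1 * ?A1 = 1\<^sub>m (r * n)"
    by (simp add: kron_mult_kron VV one_kron_one)
  have 12: "?B1 * ?A2 = 0\<^sub>m (r * n) (k * r)"
    by (simp add: kron_mult_kron uminus_kron VY zero_kron mat_uminus_zero)
  have 21: "?B2 * ?A1 = 0\<^sub>m (k * r) (r * n)"
    by (simp add: kron_mult_kron uminus_kron YV zero_kron mat_uminus_zero)
  have "?B2 * ?A2 + ?B3 * ?A3 = 1\<^sub>m k \<otimes>\<^sub>K (C * C) + 1\<^sub>m k \<otimes>\<^sub>K (D * D)"
    by (simp add: kron_mult_kron uminus_kron YY mat_mult_assoc cancel)
  also have "\<dots> = 1\<^sub>m (k * r)"
    by (simp add: kron_add CC_DD one_kron_one)
  finally have 22: "?B2 * ?A2 + ?B3 * ?A3 = 1\<^sub>m (k * r)" .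
  show ?thesis
    unfolding Q_transpose unfolding Q_def
    by (subst mult_four_block_mat[of _ "r * n" "m * n" _ "k * m" _ "k * r" _ _ "r * n" _ "k * r"])
      (auto intro!: carrier_matI simp: 11 12 21 22
        left_mult_zero_mat[of _ "k * m"] right_mult_zero_mat[of _ "k * r" "k * m"])
qed

lemma N_mult_Q: "N * Q = 0\<^sub>m (k * n + k * k) (r * n + k * r)"
proof -
  let ?N1 = "transpose_mat Y \<otimes>\<^sub>K 1\<^sub>m n" and ?N2 = "1\<^sub>m k \<otimes>\<^sub>K A" and ?N3 = "1\<^sub>m k \<otimes>\<^sub>K transpose_mat Y"
    and ?A1 = "V \<otimes>\<^sub>K 1\<^sub>m n" and ?A2 = "(- Y) \<otimes>\<^sub>K (U * C)" and ?A3 = "1\<^sub>m k \<otimes>\<^sub>K (V * D)"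
  have 11: "?N1 * ?A1 = 0\<^sub>m (k * n) (r * n)"
    by (simp add: kron_mult_kron YV zero_kron)
  have "A * (V * D) = U * C"
    by (simp add: A_def mat_mult_assoc cancel S_D)
  then have 12: "?N1 * ?A2 + ?N2 * ?A3 = 0\<^sub>m (k * n) (k * r)"
    by (simp add: kron_mult_kron uminus_kron YY mat_uminus_add)
  have 22: "?N3 * ?A3 = 0\<^sub>m (k * k) (k * r)"
    by (simp add: kron_mult_kron cancel kron_zero)
  show ?thesis
    unfolding N_def Q_def
    by (subst mult_four_block_mat[of _ "k * n" "m * n" _ "k * m" _ "k * k" _ _ "r * n" _ "k * r"])
      (auto intro!: carrier_matI simp: 11 12 22)
qed

text \<open>The off-diagonal blocks of the two products are opposite. In the upper diagonal block
  \<open>P\<close> and \<open>I - P\<close> add up to \<open>I\<close>, in the lower one \<open>C\<^sup>2\<close> and \<open>D\<^sup>2\<close> do, and both times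
  \<open>V V\<^sup>T + Y Y\<^sup>T = I\<close> remains.\<close>

lemma QQ_plus_MN: "Q * transpose_mat Q + M * N = 1\<^sub>m (m * n + k * m)"
proof -
  let ?E = "1\<^sub>m k :: real mat" and ?I = "1\<^sub>m n :: real mat"
  have complete: "V * transpose_mat V + Y * transpose_mat Y = 1\<^sub>m m"
    by (rule orthonormal_columns_complete[OF V Y VV YY VY])
  have QQ: "Q * transpose_mat Q = four_block_mat
      ((V * transpose_mat V) \<otimes>\<^sub>K ?I + (Y * transpose_mat Y) \<otimes>\<^sub>K P)
      (- (Y \<otimes>\<^sub>K (U * (C * (D * transpose_mat V)))))
      (- (transpose_mat Y \<otimes>\<^sub>K (V * (C * (D * transpose_mat U)))))
      (?E \<otimes>\<^sub>K (V * (D * (D * transpose_mat V))))"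
  proof -
    have DC: "D * (C * transpose_mat U) = C * (D * transpose_mat U)"
      by (simp add: mat_mult_assoc[symmetric] C_D)
    show ?thesis
    unfolding Q_transpose unfolding Q_def
    by (subst mult_four_block_mat[of _ "m * n" "r * n" _ "k * r" _ "k * m" _ _ "m * n" _ "k * m"])
      (auto intro!: carrier_matI simp: kron_mult_kron uminus_kron mat_mult_assoc P_def DC)
  qed
  have MN: "M * N = four_block_mat
      ((Y * transpose_mat Y) \<otimes>\<^sub>K (?I - P))
      (Y \<otimes>\<^sub>K (U * (C * (D * transpose_mat V))))
      (transpose_mat Y \<otimes>\<^sub>K (V * (C * (D * transpose_mat U))))
      (?E \<otimes>\<^sub>K (V * (C * (C * transpose_mat V))) + ?E \<otimes>\<^sub>K (Y * transpose_mat Y))"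
  proof -
    \<comment> \<open>\<open>S = C\<^sup>2 S + D\<^sup>2 S = C\<^sup>2 S + C D\<close>, so \<open>I - P\<close> turns the factor \<open>S\<close> of \<open>A\<close>
      into \<open>C D\<close>.\<close>
    have "S * transpose_mat V = (C * C + D * D) * (S * transpose_mat V)"
      by (simp add: CC_DD)
    also have "\<dots> = C * (C * (S * transpose_mat V)) + C * (D * transpose_mat V)"
      by (simp add: mat_distrib_dim mat_mult_assoc cancel) (simp add: mat_mult_assoc[symmetric] C_D)
    finally have SVt: "S * transpose_mat V
        = C * (C * (S * transpose_mat V)) + C * (D * transpose_mat V)" .
    have "A = U * (S * transpose_mat V)"
      by (simp add: A_def mat_mult_assoc)
    also have "\<dots> = U * (C * (C * (S * transpose_mat V)) + C * (D * transpose_mat V))"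
      by (simp only: SVt[symmetric])
    also have "\<dots> = P * A + U * (C * (D * transpose_mat V))"
      by (simp add: A_def P_def mat_distrib_dim mat_mult_assoc cancel)
    finally have "A = P * A + U * (C * (D * transpose_mat V))" .
    then have "A - P * A = U * (C * (D * transpose_mat V))"
      by (rule mat_diff_eqI) simp_all
    then have 12: "(1\<^sub>m n - P) * A = U * (C * (D * transpose_mat V))"
      by (simp add: mat_distrib_dim)
    have 22: "V * (C * (D * transpose_mat U)) * A = V * (C * (C * transpose_mat V))"
      by (simp add: A_def mat_mult_assoc cancel)
    show ?thesis
    unfolding M_def N_def
    by (subst mult_four_block_mat[of _ "m * n" "k * n" _ "k * k" _ "k * m" _ _ "m * n" _ "k * m"])
      (auto intro!: carrier_matI simp: kron_mult_kron 12 22)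
  qed
  have "P + (?I - P) = ?I" by (rule eq_matI) auto
  then have 11: "(V * transpose_mat V) \<otimes>\<^sub>K ?I + (Y * transpose_mat Y) \<otimes>\<^sub>K P
      + (Y * transpose_mat Y) \<otimes>\<^sub>K (?I - P) = 1\<^sub>m (m * n)"
    by (subst assoc_add_mat[of _ "m * n" "m * n"])
      (auto intro!: carrier_matI simp: kron_add add_kron complete one_kron_one)
  have "V * transpose_mat V = V * ((D * D + C * C) * transpose_mat V)"
    using CC_DD by (simp add: comm_add_mat[OF mult_carrier_mat[OF D D] mult_carrier_mat[OF C C]])
  also have "\<dots> = V * (D * (D * transpose_mat V)) + V * (C * (C * transpose_mat V))"
    by (simp add: mat_distrib_dim mat_mult_assoc)
  finally have "V * (D * (D * transpose_mat V)) + V * (C * (C * transpose_mat V)) = V * transpose_mat V" ..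
  then have 22: "?E \<otimes>\<^sub>K (V * (D * (D * transpose_mat V)))
      + (?E \<otimes>\<^sub>K (V * (C * (C * transpose_mat V))) + ?E \<otimes>\<^sub>K (Y * transpose_mat Y)) = 1\<^sub>m (k * m)"
    by (subst assoc_add_mat[of _ "k * m" "k * m", symmetric])
      (auto intro!: carrier_matI simp: kron_add complete one_kron_one CC_DD)
  show ?thesis
    unfolding QQ MN
    by (subst add_four_block_mat[of _ "m * n" "m * n" _ "k * m" _ "k * m"])
      (auto intro!: carrier_matI simp: 11 22 mat_uminus_add)
qed

lemma columns_orthogonal_basis: "columns_orthogonal_basis_of_kernel Q N"
  by (rule orthonormal_columns_basis_of_kernel
      [OF N_carrier Q_carrier M_carrier Q_orthonormal N_mult_Q QQ_plus_MN])

end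

theorem theorem2p5:
  fixes n m r :: nat and A U S V Y N Q S1 S2 :: "real mat"
  assumes r: "r \<le> min n m"
    and A: "A \<in> carrier_mat n m"
    and rank_A: "vec_space.rank n A \<le> r"
    and svd: "truncated_svd n m r A U S V"
    and Y: "Y \<in> carrier_mat m (m - r)"
    and AY: "A * Y = 0\<^sub>m n (m - r)"
    and YY: "transpose_mat Y * Y = 1\<^sub>m (m - r)"
    \<comment> \<open>automatic if \<open>rank A = r\<close>; if \<open>rank A < r\<close> then \<open>Y\<close> must complement \<open>V\<close>,
        since otherwise \<open>N * Q\<close> is nonzero\<close>
    and compl: "vec_space.rank n A < r \<Longrightarrow> transpose_mat V * Y = 0\<^sub>m r (m - r)"
    and N: "N = four_block_mat
              (transpose_mat Y \<otimes>\<^sub>K 1\<^sub>m n)           (1\<^sub>m (m - r) \<otimes>\<^sub>K A)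
              (0\<^sub>m ((m - r) * (m - r)) (m * n))   (1\<^sub>m (m - r) \<otimes>\<^sub>K transpose_mat Y)"
    and S1: "S1 = S * diag_powr (S ^\<^sub>m 2 + 1\<^sub>m r) (- 1 / 2)"
    and S2: "S2 = diag_powr (S ^\<^sub>m 2 + 1\<^sub>m r) (- 1 / 2)"
    and Q: "Q = four_block_mat
              (V \<otimes>\<^sub>K 1\<^sub>m n)                      ((- Y) \<otimes>\<^sub>K (U * S1))
              (0\<^sub>m ((m - r) * m) (r * n))         (1\<^sub>m (m - r) \<otimes>\<^sub>K (V * S2))"
  shows "columns_orthogonal_basis_of_kernel Q N"
proof -
  have m: "r + (m - r) = m" using r by simp
  have U: "U \<in> carrier_mat n r" and S: "S \<in> carrier_mat r r" "diagonal_mat S"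
    and V: "V \<in> carrier_mat m r" and A_eq: "A = U * S * transpose_mat V"
    and UU: "transpose_mat U * U = 1\<^sub>m r" and VV: "transpose_mat V * V = 1\<^sub>m r"
    using svd by (auto simp: truncated_svd_def)
  have VY: "transpose_mat V * Y = 0\<^sub>m r (m - r)"
  proof (cases "vec_space.rank n A < r")
    case True
    then show ?thesis by (rule compl)
  next
    case False
    then show ?thesis using kernel_orthogonal_if_full_rank[OF svd _ Y AY] by simp
  qed
  define s where "s = (\<lambda>i. S $$ (i, i))"
  define d where "d = (\<lambda>i. (s i * s i + 1) powr (- 1 / 2))"
  have S_diag: "S = mat_diag r s" unfolding s_def by (rule mat_diag_entries[OF S])
  have "S ^\<^sub>m 2 = mat_diag r (\<lambda>i. s i * s i)"
    using S(1) by (simp add: numeral_2_eq_2) (simp add: S_diag)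
  then have S2_diag: "S2 = mat_diag r d"
    unfolding S2 diag_powr_def by (intro eq_matI) (auto simp: mat_diag_def d_def)
  have "S1 = S * S2" unfolding S1 S2 ..
  then have S1_diag: "S1 = mat_diag r (\<lambda>i. s i * d i)"
    unfolding S2_diag S_diag by simp
  have transpose_diag: "transpose_mat (mat_diag r f) = mat_diag r f" for f :: "nat \<Rightarrow> real"
    by (intro eq_matI) (auto simp: mat_diag_def)
  have dd: "d i * d i = 1 / (s i * s i + 1)" for i
  proof -
    have "0 < s i * s i + 1" by (simp add: add_nonneg_pos)
    then show ?thesis
      unfolding d_def powr_add[symmetric] by (simp add: powr_minus_divide)
  qed
  have unit: "s i * d i * (s i * d i) + d i * d i = 1" for i
  proof -
    have "0 < s i * s i + 1" by (simp add: add_nonneg_pos)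
    moreover have "s i * d i * (s i * d i) + d i * d i = (s i * s i + 1) * (d i * d i)"
      by (simp add: algebra_simps)
    ultimately show ?thesis by (simp add: dd)
  qed
  interpret W: complemented_svd n r "m - r" U S V Y S1 S2
  proof
    show "S1 * S1 + S2 * S2 = 1\<^sub>m r"
      unfolding S1_diag S2_diag by (simp, intro eq_matI) (auto simp: mat_diag_def unit)
    show "S1 * S2 = S2 * S1" "S * S2 = S1" "S2 * S = S1"
      unfolding S1_diag S2_diag S_diag by (simp_all add: mult.commute)
    show "transpose_mat S1 = S1" "transpose_mat S2 = S2" "S1 \<in> carrier_mat r r" "S2 \<in> carrier_mat r r"
      unfolding S1_diag S2_diag by (simp_all add: transpose_diag)
  qed (use U S V Y UU VV YY VY in \<open>simp_all add: m\<close>)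
  have "Q = W.Q" "N = W.N"
    unfolding W.Q_def W.N_def W.A_def Q N A_eq m by simp_all
  then show ?thesis using W.columns_orthogonal_basis by simp
qed

end
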